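(* Suppose that $u:\mathbb{D}\to\mathbb{C}$ and $\varphi:\mathbb{D}\to\mathbb{D}$ are holomorphic functions and that the operator $W_{u',\varphi}:\mathcal{B}^{v_{\log}}\to H_{v_{\log}}^\infty$ is continuous. Then there exists a constant $C>0$ such that $$\|W_{u',\varphi}\|_e^{\mathcal{B}^{v_{\log}}\to H_{v_{\log}}^\infty}\le C\limsup_{n\to\infty}\frac{(n+1)\,\|J_u(\varphi^n)\|_{\mathcal{B}^{v_{\log}}}}{\|g_{n+1}\|_{\mathcal{B}^{w_{\log}}}}.$$
   Context: $\mathbb{D}$ is the open unit disk of $\mathbb{C}$ and $H(\mathbb{D})$ is the space of holomorphic functions on $\mathbb{D}$. A weight is a bounded, continuous, positive function $v:\mathbb{D}\to(0,\infty)$. For a weight $v$, $H_v^\infty$ is the Banach space of all $f\in H(\mathbb{D})$ with $\|f\|_{H_v^\infty}=\sup_{z\in\mathbb{D}}v(z)|f(z)|<\infty$, and $\mathcal{B}^v$ is the Banach space of all $f\in H(\mathbb{D})$ with $f'\in H_v^\infty$, normed by $\|f\|_{\mathcal{B}^v}=|f(0)|+\sup_{z\in\mathbb{D}}v(z)|f'(z)|$. The weights used are $v_{\log}(z)=(1-|z|)\log\left(\frac{2}{1-|z|}\right)$ and $w_{\log}(z)=\left[\log\log\left(\frac{4}{1-|z|^2}\right)\right]^{-1}$, $z\in\mathbb{D}$. For holomorphic $h:\mathbb{D}\to\mathbb{C}$ and $\varphi:\mathbb{D}\to\mathbb{D}$, $W_{h,\varphi}(f)=h\cdot(f\circ\varphi)$.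 For $f\in H(\mathbb{D})$, $J_u(f)$ is the holomorphic function $J_u(f)(z)=\int_0^z f(s)u'(s)\,ds$. $\varphi^n$ is the pointwise $n$-th power of $\varphi$; $g_n(z)=z^n$ for $n\ge1$. The essential norm of a continuous linear operator $T:X\to Y$ between Banach spaces is $\|T\|_e^{X\to Y}=\inf\{\|T-K\|^{X\to Y}: K:X\to Y \text{ compact linear operator}\}$, where $\|\cdot\|^{X\to Y}$ is the operator norm. *)

theory Defs
  imports "HOL-Complex_Analysis.Complex_Analysis"
begin

text \<open>
  A function on the open unit disk is represented by its extension by zero to the whole
  plane, so that equality of HOL functions is equality on the disk.
\<close>

abbreviation disk :: "complex set" ("\<bbbD>")
  where "\<bbbD> \<equiv> ball 0 1"

definition on_disk :: "(complex \<Rightarrow> complex) \<Rightarrow> complex \<Rightarrow> complex"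
  where "on_disk f = (\<lambda>z. if z \<in> \<bbbD> then f z else 0)"

definition hol_disk :: "(complex \<Rightarrow> complex) set"
  where "hol_disk = {f. f holomorphic_on \<bbbD> \<and> (\<forall>z. z \<notin> \<bbbD> \<longrightarrow> f z = 0)}"

record fspace =
  fcarrier :: "(complex \<Rightarrow> complex) set"
  fnorm :: "(complex \<Rightarrow> complex) \<Rightarrow> ennreal"

definition sup_weighted :: "(complex \<Rightarrow> real) \<Rightarrow> (complex \<Rightarrow> complex) \<Rightarrow> ennreal"
  where "sup_weighted v f = (SUP z\<in>\<bbbD>. ennreal (v z * cmod (f z)))"

definition Hinf :: "(complex \<Rightarrow> real) \<Rightarrow> fspace"
  where "Hinf v = \<lparr> fcarrier = {f \<in> hol_disk. sup_weighted v f < \<infinity>},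
                    fnorm = sup_weighted v \<rparr>"

definition Bloch :: "(complex \<Rightarrow> real) \<Rightarrow> fspace"
  where "Bloch v = \<lparr> fcarrier = {f \<in> hol_disk. on_disk (deriv f) \<in> fcarrier (Hinf v)},
                     fnorm = (\<lambda>f. ennreal (cmod (f 0)) + sup_weighted v (deriv f)) \<rparr>"

definition v_log :: "complex \<Rightarrow> real"
  where "v_log z = (1 - cmod z) * ln (2 / (1 - cmod z))"

definition w_log :: "complex \<Rightarrow> real"
  where "w_log z = inverse (ln (ln (4 / (1 - (cmod z)\<^sup>2))))"

text \<open>
  Off the carrier the distance is set to 0, since the locale for metric spaces
  asks for symmetry on the whole type.
\<close>

definition fdist :: "fspace \<Rightarrow> (complex \<Rightarrow> complex) \<Rightarrow> (complex \<Rightarrow> complex) \<Rightarrow> real"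
  where "fdist X f g =
    (if f \<in> fcarrier X \<and> g \<in> fcarrier X then enn2real (fnorm X (\<lambda>z. f z - g z)) else 0)"

definition ftop :: "fspace \<Rightarrow> (complex \<Rightarrow> complex) topology"
  where "ftop X = Metric_space.mtopology (fcarrier X) (fdist X)"

definition linear_op ::
    "fspace \<Rightarrow> fspace \<Rightarrow> ((complex \<Rightarrow> complex) \<Rightarrow> complex \<Rightarrow> complex) \<Rightarrow> bool"
  where "linear_op X Y T \<longleftrightarrow>
    (\<forall>f\<in>fcarrier X. T f \<in> fcarrier Y) \<and>
    (\<forall>f\<in>fcarrier X. \<forall>g\<in>fcarrier X. T (\<lambda>z. f z + g z) = (\<lambda>z. T f z + T g z)) \<and>
    (\<forall>c. \<forall>f\<in>fcarrier X. T (\<lambda>z. c * f z) = (\<lambda>z. c * T f z))"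

definition continuous_linear_op ::
    "fspace \<Rightarrow> fspace \<Rightarrow> ((complex \<Rightarrow> complex) \<Rightarrow> complex \<Rightarrow> complex) \<Rightarrow> bool"
  where "continuous_linear_op X Y T \<longleftrightarrow>
    linear_op X Y T \<and> continuous_map (ftop X) (ftop Y) T"

definition unit_ball :: "fspace \<Rightarrow> (complex \<Rightarrow> complex) set"
  where "unit_ball X = {f \<in> fcarrier X. fnorm X f \<le> 1}"

definition compact_linear_op ::
    "fspace \<Rightarrow> fspace \<Rightarrow> ((complex \<Rightarrow> complex) \<Rightarrow> complex \<Rightarrow> complex) \<Rightarrow> bool"
  where "compact_linear_op X Y K \<longleftrightarrow>
    linear_op X Y K \<and> compactin (ftop Y) (ftop Y closure_of (K ` unit_ball X))"

definition op_norm ::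
    "fspace \<Rightarrow> fspace \<Rightarrow> ((complex \<Rightarrow> complex) \<Rightarrow> complex \<Rightarrow> complex) \<Rightarrow> ennreal"
  where "op_norm X Y T = (SUP f\<in>unit_ball X. fnorm Y (T f))"

definition ess_norm ::
    "fspace \<Rightarrow> fspace \<Rightarrow> ((complex \<Rightarrow> complex) \<Rightarrow> complex \<Rightarrow> complex) \<Rightarrow> ennreal"
  where "ess_norm X Y T = (INF K\<in>{K. compact_linear_op X Y K}. op_norm X Y (\<lambda>f z. T f z - K f z))"

definition W_op ::
    "(complex \<Rightarrow> complex) \<Rightarrow> (complex \<Rightarrow> complex) \<Rightarrow> (complex \<Rightarrow> complex) \<Rightarrow> complex \<Rightarrow> complex"
  where "W_op h \<phi> f = on_disk (\<lambda>z. h z * f (\<phi> z))"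

definition J_op :: "(complex \<Rightarrow> complex) \<Rightarrow> (complex \<Rightarrow> complex) \<Rightarrow> complex \<Rightarrow> complex"
  where "J_op u f = on_disk (\<lambda>z. contour_integral (linepath 0 z) (\<lambda>s. f s * deriv u s))"

definition monomial :: "nat \<Rightarrow> complex \<Rightarrow> complex"
  where "monomial n = on_disk (\<lambda>z. z ^ n)"

text \<open>
  The topology is only meaningful because \<^const>\<open>fdist\<close> is a metric; this holds for every weight that is positive on the disk,
  in particular for both logarithmic weights.
\<close>

lemma v_log_pos: "z \<in> \<bbbD> \<Longrightarrow> v_log z > 0"
  unfolding v_log_def by (intro mult_pos_pos ln_gt_zero) (auto simp: field_simps add_pos_nonneg)

lemma w_log_pos:
  assumes "z \<in> \<bbbD>" shows "w_log z > 0"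
proof -
  have "(cmod z)\<^sup>2 < 1" using assms by (simp add: abs_square_less_1)
  then have "4 \<le> 4 / (1 - (cmod z)\<^sup>2)" by (simp add: field_simps)
  moreover have "exp 1 < (4::real)" using exp_le by linarith
  ultimately have "exp 1 < 4 / (1 - (cmod z)\<^sup>2)" by linarith
  then have "1 < ln (4 / (1 - (cmod z)\<^sup>2))"
    by (metis exp_gt_zero ln_exp ln_less_cancel_iff order.strict_trans)
  then show ?thesis by (simp add: w_log_def)
qed

lemma enn2real_triangle:
  assumes "a \<le> b + c" "b < \<infinity>" "c < \<infinity>"
  shows "enn2real a \<le> enn2real b + enn2real c"
proof -
  have "enn2real a \<le> enn2real (b + c)" using assms by (intro enn2real_mono) auto
  then show ?thesis using assms by (simp add: enn2real_plus)
qed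

lemma sup_weighted_diff:
  assumes "\<And>z. z \<in> \<bbbD> \<Longrightarrow> 0 < v z"
  shows "sup_weighted v (\<lambda>z. f z - h z)
           \<le> sup_weighted v (\<lambda>z. f z - g z) + sup_weighted v (\<lambda>z. g z - h z)"
  unfolding sup_weighted_def
proof (rule SUP_least)
  fix z assume z: "z \<in> \<bbbD>"
  have "v z * cmod (f z - h z) \<le> v z * cmod (f z - g z) + v z * cmod (g z - h z)"
    using mult_left_mono[OF norm_triangle_ineq[of "f z - g z" "g z - h z"], of "v z"] assms[OF z]
    by (simp add: distrib_left)
  then have "ennreal (v z * cmod (f z - h z))
      \<le> ennreal (v z * cmod (f z - g z)) + ennreal (v z * cmod (g z - h z))"
    using assms[OF z] by (simp flip: ennreal_plus)
  also have "\<dots> \<le> (SUP z\<in>\<bbbD>. ennreal (v z * cmod (f z - g z)))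
                + (SUP z\<in>\<bbbD>. ennreal (v z * cmod (g z - h z)))"
    using z by (intro add_mono SUP_upper)
  finally show "ennreal (v z * cmod (f z - h z)) \<le> \<dots>" .
qed

lemma sup_weighted_commute: "sup_weighted v (\<lambda>z. f z - g z) = sup_weighted v (\<lambda>z. g z - f z)"
  by (simp add: sup_weighted_def norm_minus_commute)

lemma sup_weighted_eq_0:
  assumes "\<And>z. z \<in> \<bbbD> \<Longrightarrow> 0 < v z"
  shows "sup_weighted v f = 0 \<longleftrightarrow> (\<forall>z\<in>\<bbbD>. f z = 0)"
proof
  assume 0: "sup_weighted v f = 0"
  show "\<forall>z\<in>\<bbbD>. f z = 0"
  proof
    fix z assume z: "z \<in> \<bbbD>"
    have "ennreal (v z * cmod (f z)) \<le> 0"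
      unfolding 0[symmetric] sup_weighted_def using z by (rule SUP_upper)
    then show "f z = 0" using assms[OF z]
      by (simp add: ennreal_eq_0_iff mult_le_0_iff)
  qed
next
  assume "\<forall>z\<in>\<bbbD>. f z = 0"
  then show "sup_weighted v f = 0" by (simp add: sup_weighted_def)
qed

lemma sup_weighted_fin_diff:
  assumes "\<And>z. z \<in> \<bbbD> \<Longrightarrow> 0 < v z" "sup_weighted v f < \<infinity>" "sup_weighted v g < \<infinity>"
  shows "sup_weighted v (\<lambda>z. f z - g z) < \<infinity>"
proof -
  have "sup_weighted v (\<lambda>z. f z - g z) \<le> sup_weighted v f + sup_weighted v g"
    using sup_weighted_diff[of v f g "\<lambda>_. 0"] assms(1)
      sup_weighted_commute[of v "\<lambda>_. 0" g] by simp
  also have "\<dots> < \<infinity>" using assms by simp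
  finally show ?thesis .
qed

lemma sup_weighted_cong:
  "(\<And>z. z \<in> \<bbbD> \<Longrightarrow> f z = g z) \<Longrightarrow> sup_weighted v f = sup_weighted v g"
  by (simp add: sup_weighted_def)

lemma deriv_diff_disk:
  "\<lbrakk>f \<in> hol_disk; g \<in> hol_disk; z \<in> \<bbbD>\<rbrakk> \<Longrightarrow> deriv (\<lambda>z. f z - g z) z = deriv f z - deriv g z"
  by (intro deriv_diff) (auto simp: hol_disk_def holomorphic_on_imp_differentiable_at)

lemma Metric_space_Hinf:
  assumes "\<And>z. z \<in> \<bbbD> \<Longrightarrow> 0 < v z"
  shows "Metric_space (fcarrier (Hinf v)) (fdist (Hinf v))"
proof
  fix f g assume f: "f \<in> fcarrier (Hinf v)" and g: "g \<in> fcarrier (Hinf v)"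
  have fin: "sup_weighted v (\<lambda>z. f z - g z) < \<infinity>"
    using f g by (intro sup_weighted_fin_diff assms) (auto simp: Hinf_def)
  have "(fdist (Hinf v) f g = 0) = (sup_weighted v (\<lambda>z. f z - g z) = 0)"
  proof -
    have "fdist (Hinf v) f g = enn2real (sup_weighted v (\<lambda>z. f z - g z))"
      using f g by (simp add: fdist_def) (simp add: Hinf_def)
    then show ?thesis using fin by (auto simp: enn2real_eq_0_iff)
  qed
  also have "\<dots> = (\<forall>z\<in>\<bbbD>. f z - g z = 0)"
    by (rule sup_weighted_eq_0) (rule assms)
  also have "\<dots> = (f = g)"
  proof
    assume *: "\<forall>z\<in>\<bbbD>. f z - g z = 0"
    show "f = g"
    proof
      fix z show "f z = g z"
        using f g * by (cases "z \<in> \<bbbD>") (auto simp: Hinf_def hol_disk_def)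
    qed
  qed simp
  finally show "(fdist (Hinf v) f g = 0) = (f = g)" .
  fix h assume h: "h \<in> fcarrier (Hinf v)"
  have fin2: "sup_weighted v (\<lambda>z. g z - h z) < \<infinity>"
    using h g by (intro sup_weighted_fin_diff assms) (auto simp: Hinf_def)
  show "fdist (Hinf v) f h \<le> fdist (Hinf v) f g + fdist (Hinf v) g h"
    using f g h enn2real_triangle[OF sup_weighted_diff[of v, OF assms] fin fin2]
    by (simp add: fdist_def) (simp add: Hinf_def)
next
  fix f g
  show "fdist (Hinf v) f g = fdist (Hinf v) g f"
    using sup_weighted_commute[of v f g] by (simp add: fdist_def) (simp add: Hinf_def)
qed (simp add: fdist_def)

lemma Metric_space_Bloch:
  assumes "\<And>z. z \<in> \<bbbD> \<Longrightarrow> 0 < v z"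
  shows "Metric_space (fcarrier (Bloch v)) (fdist (Bloch v))"
proof -
  have c: "sup_weighted v (on_disk f) = sup_weighted v f" for f
    by (rule sup_weighted_cong) (simp add: on_disk_def)
  have carr: "f \<in> hol_disk \<and> sup_weighted v (deriv f) < \<infinity>" if "f \<in> fcarrier (Bloch v)" for f
    using that by (auto simp: Bloch_def Hinf_def c)
  have D: "sup_weighted v (deriv (\<lambda>z. f z - g z)) = sup_weighted v (\<lambda>z. deriv f z - deriv g z)"
    if "f \<in> fcarrier (Bloch v)" "g \<in> fcarrier (Bloch v)" for f g
    using carr that by (intro sup_weighted_cong deriv_diff_disk) auto
  have fin: "sup_weighted v (\<lambda>z. deriv f z - deriv g z) < \<infinity>"
    if "f \<in> fcarrier (Bloch v)" "g \<in> fcarrier (Bloch v)" for f g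
    using carr that by (intro sup_weighted_fin_diff assms) auto
  have d: "fdist (Bloch v) f g
      = cmod (f 0 - g 0) + enn2real (sup_weighted v (\<lambda>z. deriv f z - deriv g z))"
    if "f \<in> fcarrier (Bloch v)" "g \<in> fcarrier (Bloch v)" for f g
  proof -
    have "fdist (Bloch v) f g = enn2real (fnorm (Bloch v) (\<lambda>z. f z - g z))"
      using that by (simp add: fdist_def)
    also have "\<dots> = enn2real (ennreal (cmod (f 0 - g 0)) + sup_weighted v (\<lambda>z. deriv f z - deriv g z))"
      using D[OF that] by (simp add: Bloch_def)
    finally show ?thesis
      using fin[OF that] by (simp add: enn2real_plus)
  qed
  show ?thesis
  proof
    fix f g
    show "0 \<le> fdist (Bloch v) f g" by (simp add: fdist_def)
  next
    fix f g
    show "fdist (Bloch v) f g = fdist (Bloch v) g f"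
    proof (cases "f \<in> fcarrier (Bloch v) \<and> g \<in> fcarrier (Bloch v)")
      case True
      then show ?thesis
        by (simp add: d norm_minus_commute sup_weighted_commute[of v "deriv f" "deriv g"])
    qed (auto simp: fdist_def)
  next
    fix f g assume f: "f \<in> fcarrier (Bloch v)" and g: "g \<in> fcarrier (Bloch v)"
    show "(fdist (Bloch v) f g = 0) = (f = g)"
    proof
      assume "fdist (Bloch v) f g = 0"
      then have "cmod (f 0 - g 0) + enn2real (sup_weighted v (\<lambda>z. deriv f z - deriv g z)) = 0"
        by (simp only: d[OF f g])
      then have 0: "f 0 = g 0" "enn2real (sup_weighted v (\<lambda>z. deriv f z - deriv g z)) = 0"
        by (simp_all add: add_nonneg_eq_0_iff)
      then have "sup_weighted v (\<lambda>z. deriv f z - deriv g z) = 0"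
        using fin[OF f g] by (auto simp: enn2real_eq_0_iff)
      moreover have "(sup_weighted v (\<lambda>z. deriv f z - deriv g z) = 0)
          = (\<forall>z\<in>\<bbbD>. deriv f z - deriv g z = 0)"
        by (rule sup_weighted_eq_0) (rule assms)
      ultimately have eq: "deriv f z - deriv g z = 0" if "z \<in> \<bbbD>" for z
        using that by blast
      have z: "((\<lambda>z. f z - g z) has_field_derivative 0) (at z within \<bbbD>)" if "z \<in> \<bbbD>" for z
      proof -
        have "(f has_field_derivative deriv f z) (at z)" "(g has_field_derivative deriv g z) (at z)"
          using carr[OF f] carr[OF g] that
          by (auto simp: hol_disk_def intro: holomorphic_derivI[OF _ open_ball])
        from DERIV_diff[OF this] show ?thesis
          unfolding eq[OF that] by (rule has_field_derivative_at_within)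
      qed
      obtain k where k: "f z - g z = k" if "z \<in> \<bbbD>" for z
        using has_field_derivative_zero_constant[OF convex_ball z] by blast
      have "k = 0" using k[of 0] 0 by simp
      show "f = g"
      proof
        fix z show "f z = g z"
          using carr[OF f] carr[OF g] k[of z] \<open>k = 0\<close>
          by (cases "z \<in> \<bbbD>") (auto simp: hol_disk_def)
      qed
    qed (simp add: d[OF g g] sup_weighted_def)
  next
    fix f g h
    assume f: "f \<in> fcarrier (Bloch v)" and g: "g \<in> fcarrier (Bloch v)" and h: "h \<in> fcarrier (Bloch v)"
    have "enn2real (sup_weighted v (\<lambda>z. deriv f z - deriv h z))
        \<le> enn2real (sup_weighted v (\<lambda>z. deriv f z - deriv g z))
          + enn2real (sup_weighted v (\<lambda>z. deriv g z - deriv h z))"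
      using enn2real_triangle[OF sup_weighted_diff[of v, OF assms] fin[OF f g] fin[OF g h]] .
    moreover have "cmod (f 0 - h 0) \<le> cmod (f 0 - g 0) + cmod (g 0 - h 0)"
      using norm_triangle_ineq[of "f 0 - g 0" "g 0 - h 0"] by simp
    ultimately show "fdist (Bloch v) f h \<le> fdist (Bloch v) f g + fdist (Bloch v) g h"
      by (simp add: d f g h)
  qed
qed

end

theory Submission
  imports Defs
begin

text \<open>
  Write \<open>h = u'\<close>, \<open>v = v_log\<close>, and \<open>L(x) = log log (4/(1 - x\<^sup>2)) = 1/w_log(x)\<close>. Two facts about
  \<open>L\<close> carry the proof.

  Growth: integrating \<open>|f'| \<le> 1/v\<close> along a radius shows that a function \<open>f\<close> in the unit ball of
  \<open>\<B>\<^sup>v\<close> satisfies \<open>|f(w)| \<le> c\<^sub>0 L(|w|)\<close> (\<open>Bloch_v_log_growth\<close>). Approximate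
  \<open>f \<mapsto> h (f \<circ> \<phi>)\<close> by \<open>f \<mapsto> h f(r \<phi>)\<close> with \<open>r < 1\<close>. This operator is compact by Montel's theorem,
  because it sees \<open>f\<close> only on the compact disk of radius \<open>r\<close>
  (\<open>compact_linear_op_dilated_W\<close>). In the difference \<open>v |h| |f(\<phi>) - f(r \<phi>)|\<close>, the points with
  \<open>|\<phi>(z)| \<le> s\<close> contribute an amount that vanishes as \<open>r \<rightarrow> 1\<close>, as \<open>v |h|\<close> is bounded and \<open>f'\<close>
  is bounded on the disk of radius \<open>s\<close>. The points with \<open>|\<phi>(z)| > s\<close> contribute at most
  \<open>2 c\<^sub>0 v |h| L(|\<phi>|)\<close>. So the essential norm is controlled by the values of
  \<open>v |h| L(|\<phi>|)\<close> where \<open>|\<phi>|\<close> is close to 1 (\<open>op_norm_W_minus_dilated_W_le\<close>).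

  Testing: since \<open>J_u(\<phi>\<^sup>n)' = \<phi>\<^sup>n h\<close> and \<open>g_{n+1}' = (n+1) z\<^sup>n\<close>, the \<open>n\<close>-th quotient on the right
  dominates \<open>v |h| |\<phi>|\<^sup>n\<close> divided by the supremum of \<open>t\<^sup>n / L(t)\<close> over \<open>0 \<le> t < 1\<close>. The function \<open>L\<close>
  grows so slowly that this supremum is at most \<open>c\<^sub>1 / L(x)\<close> as soon as \<open>n + 1 \<ge> 1/(2(1 - x))\<close>
  (\<open>power_mult_loglog_le\<close>). For \<open>x = |\<phi>(z)|\<close> and \<open>n = \<lfloor>1/(2(1 - x))\<rfloor>\<close> one also has
  \<open>x\<^sup>n \<ge> 1/2\<close>, hence \<open>v |h| L(|\<phi>|)\<close> at \<open>z\<close> is at most \<open>2 c\<^sub>1\<close> times the \<open>n\<close>-th quotient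
  (\<open>symbol_bound_near_circle\<close>). As \<open>|\<phi>(z)| \<rightarrow> 1\<close> this \<open>n\<close> tends to infinity, so the limit superior
  appears, with the constant \<open>C = 4 c\<^sub>0 c\<^sub>1\<close>, the same for all \<open>u\<close> and \<open>\<phi>\<close>.
\<close>

section \<open>The double logarithm\<close>

text \<open>
  The reciprocal of \<^const>\<open>w_log\<close> as a function of the radius, written \<open>L\<close> in the explanations.
\<close>

definition loglog :: "real \<Rightarrow> real"
  where "loglog x = ln (ln (4 / (1 - x\<^sup>2)))"

lemma w_log_loglog: "w_log z = inverse (loglog (cmod z))"
  by (simp add: w_log_def loglog_def)

lemma one_less_ln_4_div:
  fixes x :: real
  assumes "0 \<le> x" "x < 1"
  shows "1 < ln (4 / (1 - x\<^sup>2))"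
proof -
  have "4 \<le> 4 / (1 - x\<^sup>2)"
    using assms by (simp add: field_simps abs_square_less_1)
  moreover have "exp 1 < (4::real)"
    using exp_le by linarith
  ultimately show ?thesis
    by (metis exp_gt_zero ln_exp ln_less_cancel_iff order.strict_trans order.strict_trans2)
qed

lemma loglog_pos: "0 \<le> x \<Longrightarrow> x < 1 \<Longrightarrow> 0 < loglog x"
  using one_less_ln_4_div[of x] by (simp add: loglog_def)

lemma loglog_mono:
  assumes "0 \<le> x" "x \<le> y" "y < 1"
  shows "loglog x \<le> loglog y"
proof -
  have "x\<^sup>2 \<le> y\<^sup>2" "y\<^sup>2 < 1"
    using assms by (auto simp: power_mono abs_square_less_1)
  then have "4 / (1 - x\<^sup>2) \<le> 4 / (1 - y\<^sup>2)" "0 < 4 / (1 - x\<^sup>2)"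
    by (auto intro!: divide_left_mono mult_pos_pos)
  then have "ln (4 / (1 - x\<^sup>2)) \<le> ln (4 / (1 - y\<^sup>2))"
    by (rule ln_mono)
  then show ?thesis
    using one_less_ln_4_div[of x] assms by (simp add: loglog_def)
qed

text \<open>
  For \<open>p = 4/(1 - x\<^sup>2)\<close> and \<open>q = 4/(1 - t\<^sup>2)\<close> with \<open>p > q\<close>, applying \<open>ln a \<le> a - 1\<close> to \<open>p/q\<close> gives
  \<open>ln p \<le> (p/q) ln q\<close>, as \<open>ln q > 1\<close>. A second logarithm turns the factor \<open>p/q\<close> into a summand below
  \<open>p/q\<close>, which is at most the quotient of the distances of \<open>t\<close> and \<open>x\<close> to 1, up to the factor 2.
\<close>

lemma loglog_le_add_quotient:
  assumes t: "0 \<le> t" "t < 1" and x: "0 \<le> x" "x < 1"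
  shows "loglog x \<le> loglog t + 2 * (1 - t) / (1 - x)"
proof (cases "x \<le> t")
  case True
  then have "loglog x \<le> loglog t"
    using t x by (intro loglog_mono)
  moreover have "0 \<le> 2 * (1 - t) / (1 - x)"
    using t x by simp
  ultimately show ?thesis by linarith
next
  case False
  define p q where "p = 4 / (1 - x\<^sup>2)" and "q = 4 / (1 - t\<^sup>2)"
  have "t\<^sup>2 \<le> x\<^sup>2" "x\<^sup>2 < 1" "t\<^sup>2 < 1"
    using t x False by (auto simp: power_mono abs_square_less_1)
  then have pq: "0 < p" "0 < q" "1 \<le> p / q"
    by (auto simp: p_def q_def field_simps)
  have ln_q: "1 < ln q" and ln_p: "1 < ln p"
    using one_less_ln_4_div t x by (auto simp: p_def q_def)
  have "ln p = ln q + ln (p / q)"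
    using pq by (simp add: ln_div)
  also have "\<dots> \<le> ln q + 1 * (p / q - 1)"
    using pq ln_le_minus_one[of "p / q"] by simp
  also have "\<dots> \<le> ln q + ln q * (p / q - 1)"
    using pq ln_q by (intro add_left_mono mult_right_mono) auto
  finally have "ln p \<le> ln q * (p / q)"
    by (simp add: algebra_simps)
  then have "ln (ln p) \<le> ln (ln q * (p / q))"
    using ln_p by simp
  also have "\<dots> = ln (ln q) + ln (p / q)"
    using ln_q pq by (subst ln_mult) auto
  also have "\<dots> \<le> ln (ln q) + p / q"
    using pq ln_le_minus_one[of "p / q"] by simp
  also have "p / q = (1 - t\<^sup>2) / (1 - x\<^sup>2)"
    using pq by (simp add: p_def q_def divide_simps) (simp add: algebra_simps)
  also have "\<dots> = ((1 - t) * (1 + t)) / ((1 - x) * (1 + x))"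
    by (simp add: power2_eq_square algebra_simps)
  also have "\<dots> \<le> ((1 - t) * 2) / ((1 - x) * 1)"
    using t x by (intro frac_le mult_left_mono mult_pos_pos) auto
  finally show ?thesis
    by (simp add: loglog_def p_def q_def mult.commute)
qed

text \<open>
  The sum of \<open>t\<^sup>k\<close> over \<open>k \<le> n\<close> has \<open>n + 1\<close> summands, none below \<open>t\<^sup>n\<close>, and after multiplication
  by \<open>1 - t\<close> it telescopes to \<open>1 - t\<^bsup>n+1\<^esup>\<close>.
\<close>

lemma Suc_mult_power_mult_one_minus_le:
  fixes t :: real
  assumes "0 \<le> t" "t \<le> 1"
  shows "real (n + 1) * (t ^ n * (1 - t)) \<le> 1"
proof -
  have "real (n + 1) * t ^ n = (\<Sum>k<Suc n. t ^ n)"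
    by simp
  also have "\<dots> \<le> (\<Sum>k<Suc n. t ^ k)"
    using assms by (intro sum_mono power_decreasing) auto
  finally have "(real (n + 1) * t ^ n) * (1 - t) \<le> (\<Sum>k<Suc n. t ^ k) * (1 - t)"
    using assms by (intro mult_right_mono) auto
  also have "\<dots> = 1 - t ^ Suc n"
    using one_diff_power_eq[of t "Suc n"] by (simp add: mult.commute)
  also have "\<dots> \<le> 1"
    using assms by simp
  finally show ?thesis
    by (simp only: mult.assoc)
qed

text \<open>
  This bounds \<open>t\<^sup>n / L(t)\<close> by a multiple of \<open>1 / L(x)\<close>, uniformly in \<open>t\<close>: the error term
  \<open>2 (1 - t)/(1 - x)\<close> of the preceding comparison is at most \<open>4 (n + 1) (1 - t)\<close>, and \<open>t\<^sup>n\<close> absorbs the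
  factor \<open>(n + 1) (1 - t)\<close>. The remaining constant 4 is a multiple of \<open>L(t) \<ge> L(0) > 0\<close>.
\<close>

lemma power_mult_loglog_le:
  assumes t: "0 \<le> t" "t < 1" and x: "0 \<le> x" "x < 1"
    and n: "1 / (1 - x) \<le> 2 * real (n + 1)"
  shows "t ^ n * loglog x \<le> (1 + 4 / loglog 0) * loglog t"
proof -
  have "t ^ n * loglog x \<le> t ^ n * (loglog t + 2 * (1 - t) / (1 - x))"
    using t x by (intro mult_left_mono loglog_le_add_quotient) auto
  also have "\<dots> = t ^ n * loglog t + 2 * (t ^ n * (1 - t)) * (1 / (1 - x))"
    by (simp add: distrib_left)
  also have "\<dots> \<le> 1 * loglog t + 2 * (t ^ n * (1 - t)) * (2 * real (n + 1))"
    using t n loglog_pos[of t]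
    by (intro add_mono mult_right_mono mult_left_mono power_le_one mult_nonneg_nonneg) auto
  also have "\<dots> = loglog t + 4 * (real (n + 1) * (t ^ n * (1 - t)))"
    by simp
  also have "\<dots> \<le> loglog t + 4 * 1"
    using t by (intro add_left_mono mult_left_mono Suc_mult_power_mult_one_minus_le) auto
  also have "4 * 1 \<le> 4 / loglog 0 * loglog t"
    using loglog_mono[of 0 t] loglog_pos[of 0] t by (simp add: field_simps)
  finally show ?thesis
    by (simp add: algebra_simps)
qed

section \<open>Weighted suprema and extension by zero\<close>

lemma sup_weighted_le_ennreal_iff:
  "0 \<le> c \<Longrightarrow> sup_weighted v f \<le> ennreal c \<longleftrightarrow> (\<forall>z\<in>\<bbbD>. v z * cmod (f z) \<le> c)"
  by (simp add: sup_weighted_def SUP_le_iff)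

lemma sup_weighted_upper: "z \<in> \<bbbD> \<Longrightarrow> ennreal (v z * cmod (f z)) \<le> sup_weighted v f"
  unfolding sup_weighted_def by (rule SUP_upper)

lemma sup_weighted_finiteD:
  assumes "sup_weighted v f < \<infinity>"
  obtains c where "0 \<le> c" "\<And>z. z \<in> \<bbbD> \<Longrightarrow> v z * cmod (f z) \<le> c"
proof
  show "0 \<le> enn2real (sup_weighted v f)" by simp
  fix z assume "z \<in> \<bbbD>"
  have "sup_weighted v f \<le> ennreal (enn2real (sup_weighted v f))"
    using assms by simp
  with \<open>z \<in> \<bbbD>\<close> show "v z * cmod (f z) \<le> enn2real (sup_weighted v f)"
    by (subst (asm) sup_weighted_le_ennreal_iff) auto
qed

lemma has_field_derivative_on_disk:
  assumes "(f has_field_derivative d) (at z)" "z \<in> \<bbbD>"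
  shows "(on_disk f has_field_derivative d) (at z)"
  by (rule has_field_derivative_transform_within_open[OF assms(1) open_ball assms(2)])
     (simp add: on_disk_def)

lemma holomorphic_on_disk_extension: "f holomorphic_on \<bbbD> \<Longrightarrow> on_disk f holomorphic_on \<bbbD>"
  by (erule holomorphic_transform) (simp add: on_disk_def)

section \<open>Growth of functions in the logarithmic Bloch space\<close>

lemma unit_ball_Bloch_v_logD:
  assumes "f \<in> unit_ball (Bloch v_log)"
  shows "f holomorphic_on \<bbbD>" and "cmod (f 0) \<le> 1"
    and "w \<in> \<bbbD> \<Longrightarrow> v_log w * cmod (deriv f w) \<le> 1"
proof -
  show "f holomorphic_on \<bbbD>"
    using assms by (simp add: unit_ball_def Bloch_def hol_disk_def)
  have le1: "ennreal (cmod (f 0)) + sup_weighted v_log (deriv f) \<le> ennreal 1"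
    using assms by (simp add: unit_ball_def Bloch_def)
  show "cmod (f 0) \<le> 1"
    using order_trans[OF _ le1, of "ennreal (cmod (f 0))"] by simp
  have "sup_weighted v_log (deriv f) \<le> ennreal 1"
    using order_trans[OF _ le1, of "sup_weighted v_log (deriv f)"] by simp
  then show "v_log w * cmod (deriv f w) \<le> 1" if "w \<in> \<bbbD>"
    using that by (subst (asm) sup_weighted_le_ennreal_iff) auto
qed

text \<open>
  Along the radius to \<open>z\<close>, with \<open>\<rho> = |z|\<close>, the derivative of \<open>t \<mapsto> f(t z)\<close> is at most
  \<open>\<rho> / v_log(t \<rho>)\<close>, which is the derivative of \<open>t \<mapsto> ln (ln (2/(1 - t \<rho>)))\<close>. At \<open>t = 1\<close> the argument
  satisfies \<open>2/(1 - \<rho>) \<le> 4/(1 - \<rho>\<^sup>2)\<close>; at \<open>t = 0\<close> the value is \<open>ln (ln 2)\<close>.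
\<close>

lemma Bloch_v_log_growth:
  assumes f: "f \<in> unit_ball (Bloch v_log)" and z: "z \<in> \<bbbD>"
  shows "cmod (f z) \<le> 1 - ln (ln 2) + loglog (cmod z)"
proof -
  note hol = unit_ball_Bloch_v_logD(1)[OF f] and f0 = unit_ball_Bloch_v_logD(2)[OF f]
    and deriv_le = unit_ball_Bloch_v_logD(3)[OF f]
  define \<rho> where "\<rho> = cmod z"
  have \<rho>: "0 \<le> \<rho>" "\<rho> < 1"
    using z by (auto simp: \<rho>_def)
  define \<psi> where "\<psi> = (\<lambda>t. ln (ln 2 - ln (1 - t * \<rho>)))"
  have t\<rho>: "0 \<le> t * \<rho>" "t * \<rho> < 1" "of_real t * z \<in> \<bbbD>" if "0 \<le> t" "t \<le> 1" for t
  proof -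
    show "0 \<le> t * \<rho>" using \<rho> that by simp
    show *: "t * \<rho> < 1" using \<rho> that mult_right_mono[of t 1 \<rho>] by simp
    show "of_real t * z \<in> \<bbbD>" using * that by (simp add: norm_mult \<rho>_def)
  qed
  have ln_pos: "0 < ln 2 - ln (1 - t * \<rho>)" if "0 \<le> t" "t \<le> 1" for t
    using t\<rho>[OF that] by simp
  have "cmod (f (of_real 1 * z) - f (of_real 0 * z)) \<le> \<psi> 1 - \<psi> 0"
  proof (rule differentiable_bound_general[where f = "\<lambda>t. f (of_real t * z)"])
    show "(0::real) < 1" by simp
    show "continuous_on {0..1} (\<lambda>t. f (of_real t * z))"
      using t\<rho> by (intro continuous_on_compose2[OF holomorphic_on_imp_continuous_on[OF hol]]
          continuous_intros) auto
    show "continuous_on {0..1} \<psi>"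
      unfolding \<psi>_def using t\<rho> ln_pos
      by (intro continuous_intros) (force simp: less_imp_neq[THEN not_sym])+
    fix t :: real assume t: "0 < t" "t < 1"
    have "(f has_field_derivative deriv f (of_real t * z)) (at (of_real t * z))"
      using t\<rho>[of t] t hol by (intro holomorphic_derivI[OF _ open_ball]) auto
    moreover have "((\<lambda>t. of_real t * z) has_vector_derivative z) (at t)"
      by (auto intro!: derivative_eq_intros has_vector_derivative_of_real simp: has_vector_derivative_def scaleR_conv_of_real)
    ultimately show "((\<lambda>t. f (of_real t * z)) has_vector_derivative z * deriv f (of_real t * z)) (at t)"
      using field_vector_diff_chain_at[of "\<lambda>t. of_real t * z" z t f] by (simp add: o_def)
    show "(\<psi> has_vector_derivative \<rho> / v_log (of_real t * z)) (at t)"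
      unfolding \<psi>_def has_real_derivative_iff_has_vector_derivative[symmetric]
      using t t\<rho>[of t] ln_pos[of t]
      by (auto intro!: derivative_eq_intros simp: v_log_def norm_mult \<rho>_def[symmetric] ln_div)
    have "0 < v_log (of_real t * z)" "v_log (of_real t * z) * cmod (deriv f (of_real t * z)) \<le> 1"
      using t\<rho>[of t] t by (auto intro!: v_log_pos deriv_le)
    then show "cmod (z * deriv f (of_real t * z)) \<le> \<rho> / v_log (of_real t * z)"
      using mult_left_mono[of "v_log (of_real t * z) * cmod (deriv f (of_real t * z))" 1 \<rho>] \<rho>
      by (simp add: norm_mult \<rho>_def[symmetric] field_simps)
  qed
  then have "cmod (f z - f 0) \<le> \<psi> 1 - ln (ln 2)"
    by (simp add: \<psi>_def)
  moreover have "\<psi> 1 \<le> loglog \<rho>"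
  proof -
    have "1 - \<rho>\<^sup>2 \<le> 2 * (1 - \<rho>)"
      using zero_le_power2[of "1 - \<rho>"] by (simp add: power2_diff)
    then have "4 / (2 * (1 - \<rho>)) \<le> 4 / (1 - \<rho>\<^sup>2)"
      using \<rho> by (intro divide_left_mono mult_pos_pos) (auto simp: abs_square_less_1)
    moreover have "2 / (1 - \<rho>) = 4 / (2 * (1 - \<rho>))"
      using \<rho> by (simp add: divide_simps)
    ultimately have "2 / (1 - \<rho>) \<le> 4 / (1 - \<rho>\<^sup>2)"
      by (simp only:)
    moreover have "0 < 2 / (1 - \<rho>)"
      using \<rho> by simp
    ultimately have "ln (2 / (1 - \<rho>)) \<le> ln (4 / (1 - \<rho>\<^sup>2))"
      by (rule ln_mono)
    moreover have "ln (2 / (1 - \<rho>)) = ln 2 - ln (1 - \<rho>)"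
      using \<rho> by (simp add: ln_div)
    ultimately have "ln 2 - ln (1 - \<rho>) \<le> ln (4 / (1 - \<rho>\<^sup>2))"
      by (simp only:)
    then show ?thesis
      using ln_pos[of 1] by (simp add: \<psi>_def loglog_def)
  qed
  moreover have "cmod (f z) \<le> cmod (f 0) + cmod (f z - f 0)"
    by (metis add.commute diff_add_cancel norm_triangle_ineq)
  ultimately show ?thesis
    using f0 by (simp add: \<rho>_def)
qed

text \<open>
  On the disk of radius \<open>s\<close> the weight is at least \<open>(1 - s) ln 2\<close>, which bounds \<open>f'\<close> there, and \<open>z\<close>
  and \<open>r z\<close> are at distance at most \<open>1 - r\<close>.
\<close>

lemma Bloch_v_log_dilation:
  fixes z :: complex
  assumes f: "f \<in> unit_ball (Bloch v_log)" and z: "cmod z \<le> s" "s < 1"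
    and r: "0 \<le> r" "r \<le> 1"
  shows "cmod (f z - f (of_real r * z)) \<le> (1 - r) / ((1 - s) * ln 2)"
proof -
  have s: "0 \<le> s"
    using z(1) norm_ge_zero order_trans by blast
  have deriv_le: "cmod (deriv f w) \<le> 1 / ((1 - s) * ln 2)" if "w \<in> cball 0 s" for w
  proof -
    have w: "cmod w \<le> s" "w \<in> \<bbbD>"
      using that z by auto
    have "ln 2 \<le> ln (2 / (1 - cmod w))"
      using w z by (intro ln_mono) (auto simp: field_simps)
    then have "(1 - s) * ln 2 \<le> v_log w"
      unfolding v_log_def using w z by (intro mult_mono) auto
    then have "((1 - s) * ln 2) * cmod (deriv f w) \<le> v_log w * cmod (deriv f w)"
      by (rule mult_right_mono) simp
    also have "\<dots> \<le> 1"
      by (rule unit_ball_Bloch_v_logD(3)[OF f w(2)])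
    finally show ?thesis
      using z by (simp add: field_simps)
  qed
  have rz: "cmod (of_real r * z) \<le> s"
    using r z mult_mono[of r 1 "cmod z" s] by (simp add: norm_mult)
  have "cmod (f z - f (of_real r * z)) \<le> 1 / ((1 - s) * ln 2) * cmod (z - of_real r * z)"
  proof (rule field_differentiable_bound[OF convex_cball _ deriv_le])
    fix w :: complex assume "w \<in> cball 0 s"
    then have "w \<in> \<bbbD>" using z by auto
    then show "(f has_field_derivative deriv f w) (at w within cball 0 s)"
      by (rule has_field_derivative_at_within[OF
            holomorphic_derivI[OF unit_ball_Bloch_v_logD(1)[OF f] open_ball]])
  qed (use z rz in auto)
  also have "z - of_real r * z = of_real (1 - r) * z"
    by (simp add: algebra_simps)
  also have "cmod (of_real (1 - r) * z) = (1 - r) * cmod z"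
    using r by (simp only: norm_mult norm_of_real abs_of_nonneg diff_ge_0_iff_ge)
  also have "1 / ((1 - s) * ln 2) * ((1 - r) * cmod z) \<le> 1 / ((1 - s) * ln 2) * ((1 - r) * 1)"
    using z r by (intro mult_left_mono) auto
  finally show ?thesis by simp
qed

section \<open>Test functions\<close>

text \<open>
  The parameter \<open>x\<close> is free: at exponent \<open>n\<close> the norm is compared with the value of the weight at any
  radius \<open>x\<close> whose distance to 1 is at least of order \<open>1/n\<close>.
\<close>

lemma fnorm_Bloch_monomial_le:
  assumes x: "0 \<le> x" "x < 1" and n: "1 / (1 - x) \<le> 2 * real (n + 1)"
  shows "fnorm (Bloch w_log) (monomial (n + 1))
           \<le> ennreal (real (n + 1) * (1 + 4 / loglog 0) / loglog x)"
proof -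
  have "deriv (monomial (n + 1)) z = of_nat (n + 1) * z ^ n" if "z \<in> \<bbbD>" for z
    unfolding monomial_def using that
    by (intro DERIV_imp_deriv has_field_derivative_on_disk DERIV_cong[OF DERIV_power[OF DERIV_ident]])
       auto
  then have "sup_weighted w_log (deriv (monomial (n + 1)))
      = sup_weighted w_log (\<lambda>z. of_nat (n + 1) * z ^ n)"
    by (rule sup_weighted_cong)
  also have "\<dots> \<le> ennreal (real (n + 1) * (1 + 4 / loglog 0) / loglog x)"
  proof (subst sup_weighted_le_ennreal_iff)
    show "0 \<le> real (n + 1) * (1 + 4 / loglog 0) / loglog x"
      using loglog_pos[of 0] loglog_pos[of x] x by simp
    show "\<forall>z\<in>\<bbbD>. w_log z * cmod (of_nat (n + 1) * z ^ n)
        \<le> real (n + 1) * (1 + 4 / loglog 0) / loglog x"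
    proof
      fix z :: complex assume "z \<in> \<bbbD>"
      then have t: "0 \<le> cmod z" "cmod z < 1" by auto
      have "cmod z ^ n / loglog (cmod z) \<le> (1 + 4 / loglog 0) / loglog x"
        using power_mult_loglog_le[OF t x n] loglog_pos[OF x] loglog_pos[OF t]
        by (simp add: pos_divide_le_eq pos_le_divide_eq)
      then have "real (n + 1) * (cmod z ^ n / loglog (cmod z))
          \<le> real (n + 1) * ((1 + 4 / loglog 0) / loglog x)"
        by (rule mult_left_mono) simp
      moreover have "cmod (of_nat (n + 1) * z ^ n) = real (n + 1) * cmod z ^ n"
        by (simp only: norm_mult norm_of_nat norm_power)
      ultimately show "w_log z * cmod (of_nat (n + 1) * z ^ n)
          \<le> real (n + 1) * (1 + 4 / loglog 0) / loglog x"
        by (simp add: w_log_loglog divide_simps mult_ac)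
    qed
  qed
  finally show ?thesis
    by (simp add: Bloch_def monomial_def on_disk_def)
qed

lemma deriv_J_op:
  assumes u: "u holomorphic_on \<bbbD>" and f: "f holomorphic_on \<bbbD>" and z: "z \<in> \<bbbD>"
  shows "deriv (J_op u f) z = f z * deriv u z"
proof -
  have "(\<lambda>s. f s * deriv u s) holomorphic_on \<bbbD>"
    using u f by (intro holomorphic_intros holomorphic_deriv) auto
  then obtain g where g: "\<And>s. s \<in> \<bbbD> \<Longrightarrow> (g has_field_derivative f s * deriv u s) (at s within \<bbbD>)"
    using holomorphic_convex_primitive'[OF convex_ball open_ball] by blast
  have "contour_integral (linepath 0 w) (\<lambda>s. f s * deriv u s) = g w - g 0" if "w \<in> \<bbbD>" for w
  proof (rule contour_integral_unique)
    have "path_image (linepath 0 w) \<subseteq> \<bbbD>"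
      using that closed_segment_subset[OF _ _ convex_ball, of 0 0 1 w] by simp
    from contour_integral_primitive[OF g valid_path_linepath this]
    show "((\<lambda>s. f s * deriv u s) has_contour_integral (g w - g 0)) (linepath 0 w)"
      by simp
  qed
  then have "J_op u f = on_disk (\<lambda>w. g w - g 0)"
    by (auto simp: J_op_def on_disk_def)
  moreover have "((\<lambda>w. g w - g 0) has_field_derivative f z * deriv u z) (at z)"
    using g[OF z] z by (auto intro!: derivative_eq_intros simp: at_within_open[OF z open_ball])
  ultimately show ?thesis
    using z by (simp add: DERIV_imp_deriv has_field_derivative_on_disk)
qed

lemma fnorm_Bloch_J_op_ge:
  assumes "u holomorphic_on \<bbbD>" "f holomorphic_on \<bbbD>" "z \<in> \<bbbD>"
  shows "ennreal (v z * cmod (f z * deriv u z)) \<le> fnorm (Bloch v) (J_op u f)"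
proof -
  have "ennreal (v z * cmod (f z * deriv u z)) \<le> sup_weighted v (deriv (J_op u f))"
    using sup_weighted_upper[OF assms(3), of v "deriv (J_op u f)"] deriv_J_op[OF assms] by simp
  also have "\<dots> \<le> fnorm (Bloch v) (J_op u f)"
    by (simp add: Bloch_def)
  finally show ?thesis .
qed

lemma ennreal_le_mult_of_divide_le:
  fixes a b c :: ennreal
  assumes "a / b \<le> c" "b < top" "c < top"
  shows "a \<le> c * b"
proof (cases "b = 0")
  case True
  with assms(1,3) have "a = 0"
    by (metis ennreal_divide_zero leD)
  then show ?thesis by simp
next
  case False
  then have "a = a / b * b"
    using assms(2) by (metis ennreal_divide_times ennreal_divide_self mult.right_neutral)
  also have "\<dots> \<le> c * b"
    using assms(1) by (rule mult_right_mono) simp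
  finally show ?thesis .
qed

text \<open>
  For \<open>x = |\<phi>(z)|\<close> the exponent \<open>n = \<lfloor>1/(2(1 - x))\<rfloor>\<close> balances two demands: it is large enough for
  the bound on the norm of \<open>g_{n+1}\<close> in terms of \<open>L(x)\<close>, and small enough that Bernoulli's inequality
  yields \<open>x\<^sup>n \<ge> 1 - n (1 - x) \<ge> 1/2\<close>. If \<open>x > 1 - 1/(2(N + 1))\<close>, then \<open>n \<ge> N\<close>, so every \<open>z\<close> with
  \<open>|\<phi>(z)|\<close> beyond this radius is covered by the assumed bound on the tail.
\<close>

lemma symbol_bound_near_circle:
  assumes u: "u holomorphic_on \<bbbD>" and \<phi>: "\<phi> holomorphic_on \<bbbD>" "\<phi> ` \<bbbD> \<subseteq> \<bbbD>"
    and v: "\<And>z. z \<in> \<bbbD> \<Longrightarrow> 0 < v z" and M: "0 \<le> M"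
    and ev: "\<forall>\<^sub>F n in sequentially.
          of_nat (n + 1) * fnorm (Bloch v) (J_op u (\<lambda>z. \<phi> z ^ n))
            / fnorm (Bloch w_log) (monomial (n + 1)) \<le> ennreal M"
  obtains s where "s < 1"
    "\<And>z. z \<in> \<bbbD> \<Longrightarrow> s < cmod (\<phi> z) \<Longrightarrow>
        v z * cmod (deriv u z) * loglog (cmod (\<phi> z)) \<le> 2 * (1 + 4 / loglog 0) * M"
proof -
  obtain N where N: "\<And>n. N \<le> n \<Longrightarrow>
      of_nat (n + 1) * fnorm (Bloch v) (J_op u (\<lambda>z. \<phi> z ^ n))
        / fnorm (Bloch w_log) (monomial (n + 1)) \<le> ennreal M"
    using ev by (auto simp: eventually_sequentially)
  define s where "s = 1 - 1 / (2 * (real N + 1))"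
  show thesis
  proof
    show "s < 1"
      by (simp add: s_def)
    fix z assume z: "z \<in> \<bbbD>" and s: "s < cmod (\<phi> z)"
    define x where "x = cmod (\<phi> z)"
    have x: "0 \<le> x" "x < 1"
      using z \<phi>(2) by (auto simp: x_def image_subset_iff)
    define n where "n = nat \<lfloor>1 / (2 * (1 - x))\<rfloor>"
    have n_le: "real n \<le> 1 / (2 * (1 - x))" and n_gt: "1 / (2 * (1 - x)) < real (n + 1)"
      using x by (auto simp: n_def intro: of_nat_floor) linarith
    have "real N + 1 < 1 / (2 * (1 - x))"
      using s x by (simp add: s_def x_def field_simps)
    then have "N \<le> n"
      using n_gt by simp
    have "1 - real n * (1 - x) \<le> x ^ n"
      using Bernoulli_inequality[of "x - 1" n] x by (simp add: algebra_simps)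
    moreover have "real n * (1 - x) \<le> 1 / 2"
      using n_le x by (simp add: field_simps)
    ultimately have x_n: "1 / 2 \<le> x ^ n" by simp
    define G J where "G = fnorm (Bloch w_log) (monomial (n + 1))"
      and "J = fnorm (Bloch v) (J_op u (\<lambda>z. \<phi> z ^ n))"
    define c where "c = 1 + 4 / loglog 0"
    have c: "0 < c" using loglog_pos[of 0] by (simp add: c_def add_pos_pos)
    have "1 / (1 - x) \<le> 2 * real (n + 1)"
      using n_gt x by (simp add: field_simps)
    then have G: "G \<le> ennreal (real (n + 1) * c / loglog x)"
      unfolding G_def c_def by (rule fnorm_Bloch_monomial_le[OF x])
    then have "G < top" by (rule order.strict_trans1) simp
    have "of_nat (n + 1) * J / G \<le> ennreal M"
      using N[OF \<open>N \<le> n\<close>] by (simp add: G_def J_def)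
    then have le: "of_nat (n + 1) * J \<le> ennreal M * G"
      using \<open>G < top\<close> by (intro ennreal_le_mult_of_divide_le) auto
    have "ennreal (real (n + 1) * (v z * cmod (\<phi> z ^ n * deriv u z))) \<le> of_nat (n + 1) * J"
      unfolding J_def
      using fnorm_Bloch_J_op_ge[OF u _ z, of "\<lambda>z. \<phi> z ^ n" v] \<phi>(1) v[OF z]
      by (simp add: ennreal_mult' ennreal_of_nat_eq_real_of_nat mult_left_mono holomorphic_intros del: of_nat_add of_nat_Suc)
    also have "\<dots> \<le> ennreal M * ennreal (real (n + 1) * c / loglog x)"
      using le G by (meson mult_left_mono order_trans zero_le)
    also have "\<dots> = ennreal (M * (real (n + 1) * c / loglog x))"
      using M c loglog_pos[OF x] by (intro ennreal_mult[symmetric]) auto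
    finally have "real (n + 1) * (v z * cmod (\<phi> z ^ n * deriv u z)) \<le> M * (real (n + 1) * c / loglog x)"
      using M c loglog_pos[OF x] by (subst (asm) ennreal_le_iff) auto
    then have "real (n + 1) * (v z * cmod (\<phi> z ^ n * deriv u z)) \<le> real (n + 1) * (M * c / loglog x)"
      by (simp add: mult_ac)
    then have "v z * cmod (\<phi> z ^ n * deriv u z) \<le> M * c / loglog x"
      by (rule mult_left_le_imp_le) simp
    then have "x ^ n * (v z * cmod (deriv u z) * loglog x) \<le> M * c"
      using loglog_pos[OF x] by (simp add: norm_mult norm_power x_def field_simps)
    moreover have "1 / 2 * (v z * cmod (deriv u z) * loglog x) \<le> x ^ n * (v z * cmod (deriv u z) * loglog x)"
      using x_n v[OF z] loglog_pos[OF x] by (intro mult_right_mono) auto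
    ultimately have "v z * cmod (deriv u z) * loglog x \<le> 2 * (M * c)"
      by linarith
    then show "v z * cmod (deriv u z) * loglog (cmod (\<phi> z)) \<le> 2 * (1 + 4 / loglog 0) * M"
      by (simp only: x_def c_def mult_ac)
  qed
qed

section \<open>Compact approximants\<close>

text \<open>
  The dilation \<open>f \<mapsto> f(r \<cdot>)\<close> is put in front of \<open>W\<^bsub>h,\<phi>\<^esub>\<close> because for \<open>r < 1\<close> the result depends on the
  values of \<open>f\<close> on a compact subset of \<open>\<bbbD>\<close> only; as \<open>r \<rightarrow> 1\<close> it tends to \<open>W\<^bsub>h,\<phi>\<^esub>\<close> pointwise.
\<close>

definition dilated_W :: "(complex \<Rightarrow> complex) \<Rightarrow> (complex \<Rightarrow> complex) \<Rightarrow> real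
    \<Rightarrow> (complex \<Rightarrow> complex) \<Rightarrow> complex \<Rightarrow> complex"
  where "dilated_W h \<phi> r f = W_op h \<phi> (\<lambda>w. f (of_real r * w))"

lemma dilated_W_apply:
  "dilated_W h \<phi> r f z = (if z \<in> \<bbbD> then h z * f (of_real r * \<phi> z) else 0)"
  by (simp add: dilated_W_def W_op_def on_disk_def)

context
  fixes h \<phi> :: "complex \<Rightarrow> complex" and v :: "complex \<Rightarrow> real" and c r :: real
  assumes h: "h holomorphic_on \<bbbD>" and \<phi>: "\<phi> holomorphic_on \<bbbD>" "\<phi> ` \<bbbD> \<subseteq> \<bbbD>"
    and v: "\<And>z. z \<in> \<bbbD> \<Longrightarrow> 0 < v z"
    and c: "0 \<le> c" "\<And>z. z \<in> \<bbbD> \<Longrightarrow> v z * cmod (h z) \<le> c"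
    and r: "0 \<le> r" "r < 1"
begin

lemma dilated_point: "z \<in> \<bbbD> \<Longrightarrow> of_real r * \<phi> z \<in> cball 0 r"
  using \<phi>(2) r mult_left_mono[of "cmod (\<phi> z)" 1 r] by (auto simp: norm_mult image_subset_iff less_imp_le)

lemma sup_weighted_dilated_W_diff_le:
  assumes "0 \<le> \<delta>" "\<And>w. w \<in> cball 0 r \<Longrightarrow> cmod (f w - g w) \<le> \<delta>"
  shows "sup_weighted v (\<lambda>z. dilated_W h \<phi> r f z - dilated_W h \<phi> r g z) \<le> ennreal (c * \<delta>)"
proof (subst sup_weighted_le_ennreal_iff)
  show "0 \<le> c * \<delta>" using c assms by simp
  show "\<forall>z\<in>\<bbbD>. v z * cmod (dilated_W h \<phi> r f z - dilated_W h \<phi> r g z) \<le> c * \<delta>"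
  proof
    fix z assume z: "z \<in> \<bbbD>"
    have "(v z * cmod (h z)) * cmod (f (of_real r * \<phi> z) - g (of_real r * \<phi> z)) \<le> c * \<delta>"
      using v[OF z] c z assms dilated_point[OF z] by (intro mult_mono) auto
    then show "v z * cmod (dilated_W h \<phi> r f z - dilated_W h \<phi> r g z) \<le> c * \<delta>"
      using z by (simp add: dilated_W_apply norm_mult mult.assoc flip: right_diff_distrib)
  qed
qed

lemma dilated_W_in_Hinf:
  assumes f: "f holomorphic_on \<bbbD>"
  shows "dilated_W h \<phi> r f \<in> fcarrier (Hinf v)"
proof -
  have "(\<lambda>z. h z * f (of_real r * \<phi> z)) holomorphic_on \<bbbD>"
    using dilated_point r
    by (intro holomorphic_intros h holomorphic_on_compose_gen[OF _ f, unfolded o_def] \<phi>) force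
  then have hol: "dilated_W h \<phi> r f \<in> hol_disk"
    by (simp add: hol_disk_def dilated_W_def W_op_def holomorphic_on_disk_extension) (simp add: on_disk_def)
  have "continuous_on (cball 0 r) f"
    using r by (intro holomorphic_on_imp_continuous_on holomorphic_on_subset[OF f]) auto
  then have "bounded (f ` cball 0 r)"
    by (intro compact_imp_bounded compact_continuous_image) auto
  then obtain b where b: "0 < b" "\<And>w. w \<in> cball 0 r \<Longrightarrow> cmod (f w) \<le> b"
    by (auto simp: bounded_pos)
  have "sup_weighted v (dilated_W h \<phi> r f)
      = sup_weighted v (\<lambda>z. dilated_W h \<phi> r f z - dilated_W h \<phi> r (\<lambda>_. 0) z)"
    by (rule sup_weighted_cong) (simp add: dilated_W_apply)
  also have "\<dots> \<le> ennreal (c * b)"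
    using b by (intro sup_weighted_dilated_W_diff_le) auto
  also have "\<dots> < \<infinity>" by simp
  finally show ?thesis
    using hol by (simp add: Hinf_def)
qed

lemma linear_op_dilated_W: "linear_op (Bloch v') (Hinf v) (dilated_W h \<phi> r)"
proof -
  have "f holomorphic_on \<bbbD>" if "f \<in> fcarrier (Bloch v')" for f
    using that by (simp add: Bloch_def hol_disk_def)
  then show ?thesis
    by (auto simp: linear_op_def dilated_W_in_Hinf dilated_W_apply fun_eq_iff distrib_left)
qed

text \<open>
  By Montel's theorem a sequence in the family has a subsequence converging uniformly on the disk of
  radius \<open>r\<close>, and there only the values of \<open>f\<close> enter. The limit obeys the same pointwise bound, so it
  stays in the family; this makes the image itself compact, not just relatively compact.
\<close>

lemma compactin_dilated_W_image:
  assumes B: "continuous_on \<bbbD> B"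
  shows "compactin (ftop (Hinf v))
    (dilated_W h \<phi> r ` {f \<in> hol_disk. \<forall>z\<in>\<bbbD>. cmod (f z) \<le> B z})"
    (is "compactin _ (_ ` ?F)")
proof -
  interpret Y: Metric_space "fcarrier (Hinf v)" "fdist (Hinf v)"
    by (rule Metric_space_Hinf[OF v])
  have carrier: "dilated_W h \<phi> r f \<in> fcarrier (Hinf v)" if "f \<in> ?F" for f
    using that by (auto simp: hol_disk_def intro: dilated_W_in_Hinf)
  show ?thesis
    unfolding ftop_def Y.compactin_sequentially
  proof (intro conjI allI impI)
    show "dilated_W h \<phi> r ` ?F \<subseteq> fcarrier (Hinf v)"
      using carrier by blast
    fix \<sigma> :: "nat \<Rightarrow> complex \<Rightarrow> complex"
    assume "range \<sigma> \<subseteq> dilated_W h \<phi> r ` ?F"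
    then have "\<forall>n. \<exists>f. f \<in> ?F \<and> \<sigma> n = dilated_W h \<phi> r f"
      by blast
    from choice[OF this] obtain f where f: "\<And>n. f n \<in> ?F" "\<And>n. \<sigma> n = dilated_W h \<phi> r (f n)"
      by blast
    obtain g k where g: "g holomorphic_on \<bbbD>" and k: "strict_mono (k :: nat \<Rightarrow> nat)"
      and lim: "\<And>z. z \<in> \<bbbD> \<Longrightarrow> (\<lambda>n. f (k n) z) \<longlonglongrightarrow> g z"
      and ulim: "\<And>K. compact K \<Longrightarrow> K \<subseteq> \<bbbD> \<Longrightarrow> uniform_limit K (f \<circ> k) g sequentially"
    proof (rule Montel[OF open_ball, where \<H> = ?F and \<F> = f])
      show "range f \<subseteq> ?F" using f by blast
      show "\<exists>b. \<forall>h\<in>?F. \<forall>z\<in>K. cmod (h z) \<le> b" if K: "compact K" "K \<subseteq> \<bbbD>" for K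
      proof -
        have "bounded (B ` K)"
          using K by (intro compact_imp_bounded compact_continuous_image continuous_on_subset[OF B])
        then obtain b where b: "\<And>z. z \<in> K \<Longrightarrow> \<bar>B z\<bar> \<le> b"
          by (auto simp: bounded_iff)
        show ?thesis
        proof (intro exI ballI)
          fix h z assume "h \<in> ?F" "z \<in> K"
          then have "cmod (h z) \<le> B z" using K by auto
          also have "\<dots> \<le> b" using b[OF \<open>z \<in> K\<close>] by simp
          finally show "cmod (h z) \<le> b" .
        qed
      qed
    qed (auto simp: hol_disk_def)
    have gF: "on_disk g \<in> ?F"
    proof -
      have "on_disk g holomorphic_on \<bbbD>"
        by (rule holomorphic_on_disk_extension[OF g])
      moreover have "cmod (g z) \<le> B z" if z: "z \<in> \<bbbD>" for z
        using f(1) z by (intro Lim_norm_ubound[OF _ lim[OF z]]) auto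
      ultimately show ?thesis
        by (auto simp: hol_disk_def on_disk_def)
    qed
    have "limitin Y.mtopology (\<sigma> \<circ> k) (dilated_W h \<phi> r (on_disk g)) sequentially"
      unfolding Y.limit_metric_sequentially
    proof (intro conjI allI impI carrier gF)
      fix \<epsilon> :: real assume "0 < \<epsilon>"
      define \<delta> where "\<delta> = \<epsilon> / (2 * (c + 1))"
      have \<delta>: "0 < \<delta>" "c * \<delta> < \<epsilon>"
        using \<open>0 < \<epsilon>\<close> c(1)
        by (simp_all add: \<delta>_def pos_divide_less_eq algebra_simps add_nonneg_pos)
      have "cball 0 r \<subseteq> \<bbbD>" using r by auto
      then have "\<forall>\<^sub>F n in sequentially. \<forall>w\<in>cball 0 r. dist (f (k n) w) (g w) < \<delta>"
        using uniform_limitD[OF ulim \<delta>(1), of "cball 0 r"] by simp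
      then obtain N where N: "\<And>n w. N \<le> n \<Longrightarrow> w \<in> cball 0 r \<Longrightarrow> dist (f (k n) w) (g w) < \<delta>"
        unfolding eventually_sequentially by blast
      show "\<exists>N. \<forall>n\<ge>N. (\<sigma> \<circ> k) n \<in> fcarrier (Hinf v) \<and>
          fdist (Hinf v) ((\<sigma> \<circ> k) n) (dilated_W h \<phi> r (on_disk g)) < \<epsilon>"
      proof (intro exI allI impI conjI)
        fix n assume n: "N \<le> n"
        show in_carrier: "(\<sigma> \<circ> k) n \<in> fcarrier (Hinf v)"
          using carrier f by simp
        have "cmod (f (k n) w - on_disk g w) \<le> \<delta>" if "w \<in> cball 0 r" for w
          using N[OF n that] that r by (simp add: on_disk_def dist_norm)
        then have "sup_weighted v (\<lambda>z. dilated_W h \<phi> r (f (k n)) z - dilated_W h \<phi> r (on_disk g) z)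
            \<le> ennreal (c * \<delta>)"
          using \<delta> by (intro sup_weighted_dilated_W_diff_le) auto
        then have "enn2real (sup_weighted v (\<lambda>z. dilated_W h \<phi> r (f (k n)) z - dilated_W h \<phi> r (on_disk g) z))
            \<le> c * \<delta>"
          using \<delta> c by (intro enn2real_leI) auto
        moreover have "fdist (Hinf v) ((\<sigma> \<circ> k) n) (dilated_W h \<phi> r (on_disk g))
            = enn2real (fnorm (Hinf v) (\<lambda>z. dilated_W h \<phi> r (f (k n)) z - dilated_W h \<phi> r (on_disk g) z))"
          using in_carrier carrier[OF gF] by (simp add: fdist_def f(2))
        ultimately show "fdist (Hinf v) ((\<sigma> \<circ> k) n) (dilated_W h \<phi> r (on_disk g)) < \<epsilon>"
          using \<delta> by (simp add: Hinf_def)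
      qed
    qed
    then show "\<exists>l k. l \<in> dilated_W h \<phi> r ` ?F \<and> strict_mono k \<and> limitin Y.mtopology (\<sigma> \<circ> k) l sequentially"
      using gF k by blast
  qed
qed

text \<open>
  The growth estimate places the unit ball inside a family with a continuous pointwise bound. The closure
  of the image of the ball is then a closed subset of a compact set.
\<close>

lemma compact_linear_op_dilated_W:
  "compact_linear_op (Bloch v_log) (Hinf v) (dilated_W h \<phi> r)"
proof -
  interpret Y: Metric_space "fcarrier (Hinf v)" "fdist (Hinf v)"
    by (rule Metric_space_Hinf[OF v])
  define B where "B = (\<lambda>z::complex. 1 - ln (ln 2) + loglog (cmod z))"
  define S where "S = dilated_W h \<phi> r ` {f \<in> hol_disk. \<forall>z\<in>\<bbbD>. cmod (f z) \<le> B z}"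
  have B: "continuous_on \<bbbD> B"
    unfolding B_def loglog_def
  proof (intro continuous_intros ballI)
    fix z :: complex assume "z \<in> \<bbbD>"
    then have z: "cmod z < 1" by simp
    then show "1 - (cmod z)\<^sup>2 \<noteq> 0" "4 / (1 - (cmod z)\<^sup>2) \<noteq> 0"
      by (auto simp: abs_square_eq_1)
    show "ln (4 / (1 - (cmod z)\<^sup>2)) \<noteq> 0"
      using one_less_ln_4_div[of "cmod z"] z by auto
  qed
  have S: "compactin Y.mtopology S"
    using compactin_dilated_W_image[OF B] by (simp add: S_def ftop_def)
  have "unit_ball (Bloch v_log) \<subseteq> {f \<in> hol_disk. \<forall>z\<in>\<bbbD>. cmod (f z) \<le> B z}"
    using Bloch_v_log_growth by (auto simp: B_def unit_ball_def Bloch_def)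
  then have "Y.mtopology closure_of (dilated_W h \<phi> r ` unit_ball (Bloch v_log)) \<subseteq> S"
    unfolding S_def
    by (intro closure_of_minimal image_mono)
       (use S compactin_imp_closedin Y.Hausdorff_space_mtopology S_def in auto)
  then have "compactin Y.mtopology (Y.mtopology closure_of (dilated_W h \<phi> r ` unit_ball (Bloch v_log)))"
    using closed_compactin[OF S] by simp
  then show ?thesis
    by (simp add: compact_linear_op_def linear_op_dilated_W ftop_def)
qed

end

section \<open>The essential norm\<close>

lemma one_minus_ln_ln_2_nonneg: "0 \<le> 1 - ln (ln (2::real))"
  using ln_le_minus_one[of "ln 2"] ln_le_minus_one[of 2] by simp

text \<open>
  The two summands bound the two regions: for \<open>|\<phi>(z)| \<le> s\<close> the dilation moves \<open>f(\<phi>(z))\<close> by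
  little, and for \<open>|\<phi>(z)| > s\<close> both \<open>f(\<phi>(z))\<close> and \<open>f(r \<phi>(z))\<close> are at most a multiple of
  \<open>L(|\<phi>(z)|)\<close>.
\<close>

lemma op_norm_W_minus_dilated_W_le:
  assumes \<phi>: "\<phi> ` \<bbbD> \<subseteq> \<bbbD>" and v: "\<And>z. z \<in> \<bbbD> \<Longrightarrow> 0 < v z"
    and c: "0 \<le> c" "\<And>z. z \<in> \<bbbD> \<Longrightarrow> v z * cmod (h z) \<le> c"
    and r: "0 \<le> r" "r < 1" and s: "s < 1"
    and A: "0 \<le> A"
      "\<And>z. z \<in> \<bbbD> \<Longrightarrow> s < cmod (\<phi> z) \<Longrightarrow> v z * cmod (h z) * loglog (cmod (\<phi> z)) \<le> A"
  shows "op_norm (Bloch v_log) (Hinf v) (\<lambda>f z. W_op h \<phi> f z - dilated_W h \<phi> r f z)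
    \<le> ennreal (c * ((1 - r) / ((1 - s) * ln 2)) + 2 * (1 + (1 - ln (ln 2)) / loglog 0) * A)"
    (is "_ \<le> ennreal (?near + 2 * ?c\<^sub>0 * A)")
  unfolding op_norm_def
proof (rule SUP_least)
  fix f assume f: "f \<in> unit_ball (Bloch v_log)"
  note ln_ln_2 = one_minus_ln_ln_2_nonneg
  then have c0: "0 \<le> ?c\<^sub>0"
    using loglog_pos[of 0] by simp
  have nonneg: "0 \<le> ?near" "0 \<le> 2 * ?c\<^sub>0 * A"
    using c(1) r s by simp (intro mult_nonneg_nonneg c0 A(1), simp)
  have growth: "cmod (f w) \<le> ?c\<^sub>0 * loglog (cmod z)"
    if "z \<in> \<bbbD>" "cmod w \<le> cmod z" for w z
  proof -
    have "cmod (f w) \<le> 1 - ln (ln 2) + loglog (cmod w)"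
      using that by (intro Bloch_v_log_growth f) auto
    also have "loglog (cmod w) \<le> loglog (cmod z)"
      using that by (intro loglog_mono) auto
    also have "1 - ln (ln 2) \<le> (1 - ln (ln 2)) / loglog 0 * loglog (cmod z)"
      using ln_ln_2 loglog_pos[of 0] loglog_mono[of 0 "cmod z"] that mult_left_mono[of "loglog 0" "loglog (cmod z)" "1 - ln (ln 2)"]
      by (simp add: field_simps)
    finally show ?thesis
      by (simp add: algebra_simps)
  qed
  have "v z * cmod (h z * (f (\<phi> z) - f (of_real r * \<phi> z))) \<le> ?near + 2 * ?c\<^sub>0 * A"
    if z: "z \<in> \<bbbD>" for z
  proof (cases "cmod (\<phi> z) \<le> s")
    case True
    have "(v z * cmod (h z)) * cmod (f (\<phi> z) - f (of_real r * \<phi> z)) \<le> ?near"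
      using True z v[OF z] c r s
      by (intro mult_mono Bloch_v_log_dilation[OF f]) auto
    then show ?thesis
      using nonneg by (simp add: norm_mult mult.assoc)
  next
    case False
    have \<phi>z: "\<phi> z \<in> \<bbbD>" using z \<phi> by blast
    have "cmod (of_real r * \<phi> z) \<le> cmod (\<phi> z)"
      using r by (simp add: norm_mult mult_left_le_one_le)
    then have "cmod (f (of_real r * \<phi> z)) \<le> ?c\<^sub>0 * loglog (cmod (\<phi> z))"
      by (rule growth[OF \<phi>z])
    moreover have "cmod (f (\<phi> z)) \<le> ?c\<^sub>0 * loglog (cmod (\<phi> z))"
      by (rule growth[OF \<phi>z order_refl])
    ultimately have "cmod (f (\<phi> z) - f (of_real r * \<phi> z))
        \<le> ?c\<^sub>0 * loglog (cmod (\<phi> z)) + ?c\<^sub>0 * loglog (cmod (\<phi> z))"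
      by (intro order_trans[OF norm_triangle_ineq4] add_mono)
    then have "cmod (f (\<phi> z) - f (of_real r * \<phi> z)) \<le> 2 * ?c\<^sub>0 * loglog (cmod (\<phi> z))"
      by (simp only: mult_2 distrib_right)
    then have "(v z * cmod (h z)) * cmod (f (\<phi> z) - f (of_real r * \<phi> z))
        \<le> (v z * cmod (h z)) * (2 * ?c\<^sub>0 * loglog (cmod (\<phi> z)))"
      using v[OF z] by (intro mult_left_mono) auto
    also have "\<dots> = 2 * ?c\<^sub>0 * (v z * cmod (h z) * loglog (cmod (\<phi> z)))"
      by (simp only: mult_ac)
    also have "\<dots> \<le> 2 * ?c\<^sub>0 * A"
      using False by (intro mult_left_mono mult_nonneg_nonneg c0 A(2)[OF z]) auto
    finally show ?thesis
      using nonneg by (simp add: norm_mult mult.assoc)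
  qed
  then have "sup_weighted v (\<lambda>z. W_op h \<phi> f z - dilated_W h \<phi> r f z) \<le> ennreal (?near + 2 * ?c\<^sub>0 * A)"
    using nonneg
    by (subst sup_weighted_le_ennreal_iff)
       (auto simp: W_op_def dilated_W_apply on_disk_def simp flip: right_diff_distrib)
  then show "fnorm (Hinf v) (\<lambda>z. W_op h \<phi> f z - dilated_W h \<phi> r f z) \<le> ennreal (?near + 2 * ?c\<^sub>0 * A)"
    by (simp add: Hinf_def)
qed

text \<open>
  The image of the constant function 1 is \<open>h\<close>.
\<close>

lemma bounded_symbol_of_W_op:
  assumes W: "linear_op (Bloch v) (Hinf v') (W_op h \<phi>)" and \<phi>: "\<phi> ` \<bbbD> \<subseteq> \<bbbD>"
  shows "sup_weighted v' h < \<infinity>"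
proof -
  have "deriv (on_disk (\<lambda>_. 1)) z = 0" if "z \<in> \<bbbD>" for z
    by (intro DERIV_imp_deriv has_field_derivative_on_disk DERIV_const that)
  then have "on_disk (deriv (on_disk (\<lambda>_. 1))) = (\<lambda>_. 0)"
    by (auto simp: on_disk_def fun_eq_iff)
  moreover have "(\<lambda>_. 0) \<in> fcarrier (Hinf v)"
    by (simp add: Hinf_def hol_disk_def sup_weighted_def)
  moreover have "on_disk (\<lambda>_. 1) \<in> hol_disk"
    using holomorphic_on_disk_extension[of "\<lambda>_. 1"] by (simp add: hol_disk_def) (simp add: on_disk_def)
  ultimately have "on_disk (\<lambda>_. 1) \<in> fcarrier (Bloch v)"
    by (simp add: Bloch_def)
  then have "W_op h \<phi> (on_disk (\<lambda>_. 1)) \<in> fcarrier (Hinf v')"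
    using W by (simp add: linear_op_def)
  then have "sup_weighted v' (W_op h \<phi> (on_disk (\<lambda>_. 1))) < \<infinity>"
    by (simp add: Hinf_def)
  also have "sup_weighted v' (W_op h \<phi> (on_disk (\<lambda>_. 1))) = sup_weighted v' h"
  proof (rule sup_weighted_cong)
    fix z assume "z \<in> \<bbbD>"
    moreover from this have "\<phi> z \<in> \<bbbD>" using \<phi> by blast
    ultimately show "W_op h \<phi> (on_disk (\<lambda>_. 1)) z = h z"
      by (simp add: W_op_def on_disk_def)
  qed
  finally show ?thesis .
qed

theorem corollary3p3:
  fixes u \<phi> :: "complex \<Rightarrow> complex"
  assumes "u holomorphic_on \<bbbD>"
    and "\<phi> holomorphic_on \<bbbD>" and "\<phi> ` \<bbbD> \<subseteq> \<bbbD>"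
    and "continuous_linear_op (Bloch v_log) (Hinf v_log) (W_op (deriv u) \<phi>)"
  shows "\<exists>C::real. C > 0 \<and>
    ess_norm (Bloch v_log) (Hinf v_log) (W_op (deriv u) \<phi>)
      \<le> ennreal C * limsup (\<lambda>n::nat.
          of_nat (n + 1) * fnorm (Bloch v_log) (J_op u (\<lambda>z. \<phi> z ^ n))
            / fnorm (Bloch w_log) (monomial (n + 1)))"
proof -
  define a where "a = (\<lambda>n::nat. of_nat (n + 1) * fnorm (Bloch v_log) (J_op u (\<lambda>z. \<phi> z ^ n))
      / fnorm (Bloch w_log) (monomial (n + 1)))"
  define c\<^sub>0 c\<^sub>1 where "c\<^sub>0 = 1 + (1 - ln (ln 2)) / loglog 0" and "c\<^sub>1 = 1 + 4 / loglog 0"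
  define C where "C = 4 * c\<^sub>0 * c\<^sub>1"
  have c\<^sub>0: "0 < c\<^sub>0" and c\<^sub>1: "0 < c\<^sub>1"
    using loglog_pos[of 0] one_minus_ln_ln_2_nonneg
    by (auto simp: c\<^sub>0_def c\<^sub>1_def intro!: add_pos_nonneg)
  then have C: "0 < C" by (simp add: C_def)
  have "sup_weighted v_log (deriv u) < \<infinity>"
    using assms(3,4) bounded_symbol_of_W_op by (auto simp: continuous_linear_op_def)
  then obtain c where c: "0 \<le> c" "\<And>z. z \<in> \<bbbD> \<Longrightarrow> v_log z * cmod (deriv u z) \<le> c"
    by (rule sup_weighted_finiteD) blast
  have hol: "deriv u holomorphic_on \<bbbD>"
    using assms(1) by (intro holomorphic_deriv) auto
  have "ess_norm (Bloch v_log) (Hinf v_log) (W_op (deriv u) \<phi>) \<le> ennreal C * limsup a"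
  proof (cases "limsup a = top")
    case True
    then show ?thesis
      using C by (simp add: ennreal_mult_top)
  next
    case False
    then obtain l where l: "0 \<le> l" "limsup a = ennreal l"
      by (cases "limsup a") auto
    show ?thesis
    proof (rule ennreal_le_epsilon)
      fix \<epsilon> :: real assume \<epsilon>: "0 < \<epsilon>"
      \<comment> \<open>The factor \<open>C\<close> turns the excess over \<open>l\<close> into \<open>\<epsilon>/2\<close>; the rest is left to the points with small \<open>|\<phi>(z)|\<close>.\<close>
      define M where "M = l + \<epsilon> / (2 * C)"
      have M: "0 \<le> M" "l < M"
        using l \<epsilon> C by (auto simp: M_def)
      then have "limsup a < ennreal M"
        using l by (simp add: ennreal_less_iff)
      then have "\<forall>\<^sub>F n in sequentially. a n \<le> ennreal M"
        by (rule eventually_mono[OF Limsup_lessD]) simp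
      then obtain s where s: "s < 1" "\<And>z. z \<in> \<bbbD> \<Longrightarrow> s < cmod (\<phi> z) \<Longrightarrow>
          v_log z * cmod (deriv u z) * loglog (cmod (\<phi> z)) \<le> 2 * c\<^sub>1 * M"
        using symbol_bound_near_circle[where v = v_log, OF assms(1-3) v_log_pos M(1)]
        unfolding a_def c\<^sub>1_def by blast
      \<comment> \<open>Chosen so that the points with \<open>|\<phi>(z)| \<le> s\<close> contribute at most \<open>\<epsilon>/2\<close> for \<open>r = 1 - d\<close>.\<close>
      define d where "d = min 1 (\<epsilon> * ((1 - s) * ln 2) / (2 * (c + 1)))"
      have d: "0 < d" "d \<le> 1" "c * (d / ((1 - s) * ln 2)) \<le> \<epsilon> / 2"
      proof -
        have p: "0 < (1 - s) * ln 2" using s(1) by simp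
        then show "0 < d" "d \<le> 1" using \<epsilon> c by (auto simp: d_def)
        have "d / ((1 - s) * ln 2) \<le> (\<epsilon> * ((1 - s) * ln 2) / (2 * (c + 1))) / ((1 - s) * ln 2)"
          using p by (intro divide_right_mono) (auto simp: d_def)
        also have "\<dots> = \<epsilon> / (2 * (c + 1))"
          using s(1) by simp
        finally have "c * (d / ((1 - s) * ln 2)) \<le> c * (\<epsilon> / (2 * (c + 1)))"
          using c(1) by (rule mult_left_mono)
        also have "\<dots> \<le> \<epsilon> / 2"
          using c(1) \<epsilon> by (simp add: field_simps)
        finally show "c * (d / ((1 - s) * ln 2)) \<le> \<epsilon> / 2" .
      qed
      define K where "K = dilated_W (deriv u) \<phi> (1 - d)"
      have "compact_linear_op (Bloch v_log) (Hinf v_log) K"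
        unfolding K_def using d
        by (intro compact_linear_op_dilated_W[OF hol assms(2,3) v_log_pos c]) auto
      then have "ess_norm (Bloch v_log) (Hinf v_log) (W_op (deriv u) \<phi>)
          \<le> op_norm (Bloch v_log) (Hinf v_log) (\<lambda>f z. W_op (deriv u) \<phi> f z - K f z)"
        unfolding ess_norm_def by (intro INF_lower) simp
      also have "\<dots> \<le> ennreal (c * ((1 - (1 - d)) / ((1 - s) * ln 2)) + 2 * c\<^sub>0 * (2 * c\<^sub>1 * M))"
        unfolding K_def c\<^sub>0_def using d s(2) c\<^sub>1 M(1)
        by (intro op_norm_W_minus_dilated_W_le[OF assms(3) v_log_pos c _ _ s(1)]) auto
      also have "\<dots> \<le> ennreal (C * l + \<epsilon>)"
      proof (rule ennreal_leI)
        have "2 * c\<^sub>0 * (2 * c\<^sub>1 * M) = C * M"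
          by (simp add: C_def)
        also have "\<dots> = C * l + \<epsilon> / 2"
          using C by (simp add: M_def distrib_left)
        finally have "2 * c\<^sub>0 * (2 * c\<^sub>1 * M) = C * l + \<epsilon> / 2" .
        moreover have "1 - (1 - d) = d" by simp
        ultimately show "c * ((1 - (1 - d)) / ((1 - s) * ln 2)) + 2 * c\<^sub>0 * (2 * c\<^sub>1 * M) \<le> C * l + \<epsilon>"
          using d(3) by (simp only:)
      qed
      also have "\<dots> = ennreal C * limsup a + ennreal \<epsilon>"
        using l C \<epsilon> by (simp add: ennreal_mult)
      finally show "ess_norm (Bloch v_log) (Hinf v_log) (W_op (deriv u) \<phi>)
          \<le> ennreal C * limsup a + ennreal \<epsilon>" .
    qed
  qed
  with C show ?thesis
    unfolding a_def by blast
qed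

end
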